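(* Let $(\Delta,\Gamma)$ be a relative simplicial complex, and let $\varphi$ be a folding map on $(\Delta,\Gamma)$. If the complex $(\Delta,\Gamma)$ is partitionable, then its image $(\Delta',\Gamma')$ under $\varphi$ is also partitionable.
   Context: A simplicial complex is a collection of subsets of a finite ground set closed under inclusion. A relative simplicial complex $(\Delta,\Gamma)$ is a pair of simplicial complexes with $\Gamma$ a subcomplex of $\Delta$ ($\Gamma=\varnothing$, the empty collection, is allowed). Its faces are the faces of $\Delta$ not in $\Gamma$, and its facets are the inclusion-maximal such faces. $(\Delta,\Gamma)$ is partitionable if its set of faces $\Delta\setminus\Gamma$ is the disjoint union of intervals $[R(\sigma),\sigma]=\{\rho : R(\sigma)\subseteq\rho\subseteq\sigma\}$, one for each facet $\sigma$ of $(\Delta,\Gamma)$, with $R(\sigma)\subseteq\sigma$ a face of $(\Delta,\Gamma)$. Folding map: a surjective, dimension-preserving simplicial map $\varphi:\Delta\to\Delta'$ between simplicial complexes is a folding map over (on) $(\Delta,\Gamma)$ if (F1) it induces a bijection from the faces of $(\Delta,\Gamma)$ to the faces of a relative simplicial complex $(\Delta',\Gamma')$, for some subcomplex $\Gamma'\subseteq\Delta'$ (necessarily $\Gamma'=\Delta'\setminus\varphi(\Delta\setminus\Gamma)$); and (F2) it sends facets of $(\Delta,\Gamma)$ to facets of $(\Delta',\Gamma')$. The relative complex $(\Delta',\Gamma')$ is called the image of $(\Delta,\Gamma)$ under $\varphi$. *)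

theory Defs
  imports Main "HOL-Library.Disjoint_Sets"
begin

text \<open>
  Complexes here are abstract; \<open>simplicial_complex\<close> of \<open>HOL-Analysis\<close> is the geometric notion.
  Both the empty collection and the collection consisting of the empty face are complexes.
\<close>

definition abstract_complex :: "'a set set \<Rightarrow> bool" where
  "abstract_complex \<Delta> \<longleftrightarrow>
     (\<exists>V. finite V \<and> \<Delta> \<subseteq> Pow V) \<and> (\<forall>\<sigma>\<in>\<Delta>. \<forall>\<rho>. \<rho> \<subseteq> \<sigma> \<longrightarrow> \<rho> \<in> \<Delta>)"

definition relative_complex :: "'a set set \<Rightarrow> 'a set set \<Rightarrow> bool" where
  "relative_complex \<Delta> \<Gamma> \<longleftrightarrow> abstract_complex \<Delta> \<and> abstract_complex \<Gamma> \<and> \<Gamma> \<subseteq> \<Delta>"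

definition faces :: "'a set set \<Rightarrow> 'a set set \<Rightarrow> 'a set set" where
  "faces \<Delta> \<Gamma> = \<Delta> - \<Gamma>"

definition facets :: "'a set set \<Rightarrow> 'a set set \<Rightarrow> 'a set set" where
  "facets \<Delta> \<Gamma> = {\<sigma> \<in> faces \<Delta> \<Gamma>. \<forall>\<tau>\<in>faces \<Delta> \<Gamma>. \<sigma> \<subseteq> \<tau> \<longrightarrow> \<tau> = \<sigma>}"

text \<open>On sets, \<open>{R \<sigma>..\<sigma>}\<close> is the interval of all \<open>\<rho>\<close> with \<open>R \<sigma> \<subseteq> \<rho> \<subseteq> \<sigma>\<close>.\<close>

definition partitionable :: "'a set set \<Rightarrow> 'a set set \<Rightarrow> bool" where
  "partitionable \<Delta> \<Gamma> \<longleftrightarrow>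
     (\<exists>R. (\<forall>\<sigma>\<in>facets \<Delta> \<Gamma>. R \<sigma> \<in> faces \<Delta> \<Gamma> \<and> R \<sigma> \<subseteq> \<sigma>) \<and>
          disjoint_family_on (\<lambda>\<sigma>. {R \<sigma>..\<sigma>}) (facets \<Delta> \<Gamma>) \<and>
          faces \<Delta> \<Gamma> = (\<Union>\<sigma>\<in>facets \<Delta> \<Gamma>. {R \<sigma>..\<sigma>}))"

definition face_dim :: "'a set \<Rightarrow> int" where
  "face_dim \<sigma> = int (card \<sigma>) - 1"

text \<open>
  A simplicial map is given by a map \<open>\<phi>\<close> on vertices, its values outside \<open>\<Union>\<Delta>\<close> being irrelevant,
  and acts on a face \<open>\<sigma>\<close> by \<open>\<phi> ` \<sigma>\<close>.
\<close>

definition simplicial_map :: "('a \<Rightarrow> 'b) \<Rightarrow> 'a set set \<Rightarrow> 'b set set \<Rightarrow> bool" where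
  "simplicial_map \<phi> \<Delta> \<Delta>' \<longleftrightarrow> (\<forall>\<sigma>\<in>\<Delta>. \<phi> ` \<sigma> \<in> \<Delta>')"

definition dimension_preserving :: "('a \<Rightarrow> 'b) \<Rightarrow> 'a set set \<Rightarrow> bool" where
  "dimension_preserving \<phi> \<Delta> \<longleftrightarrow> (\<forall>\<sigma>\<in>\<Delta>. face_dim (\<phi> ` \<sigma>) = face_dim \<sigma>)"

text \<open>Surjectivity is meant on faces: every face of \<open>\<Delta>'\<close> is the image of a face of \<open>\<Delta>\<close>.\<close>

definition folding_map ::
    "('a \<Rightarrow> 'b) \<Rightarrow> 'a set set \<Rightarrow> 'a set set \<Rightarrow> 'b set set \<Rightarrow> bool" where
  "folding_map \<phi> \<Delta> \<Gamma> \<Delta>' \<longleftrightarrow>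
     abstract_complex \<Delta>' \<and>
     simplicial_map \<phi> \<Delta> \<Delta>' \<and>
     (\<lambda>\<sigma>. \<phi> ` \<sigma>) ` \<Delta> = \<Delta>' \<and>
     dimension_preserving \<phi> \<Delta> \<and>
     (\<exists>\<Gamma>'. relative_complex \<Delta>' \<Gamma>' \<and>
           bij_betw (\<lambda>\<sigma>. \<phi> ` \<sigma>) (faces \<Delta> \<Gamma>) (faces \<Delta>' \<Gamma>') \<and>
           (\<forall>\<sigma>\<in>facets \<Delta> \<Gamma>. \<phi> ` \<sigma> \<in> facets \<Delta>' \<Gamma>'))"

text \<open>The subcomplex \<open>\<Gamma>'\<close> in \<open>folding_map\<close> is determined by the remaining data.\<close>

definition folding_subcomplex ::
    "('a \<Rightarrow> 'b) \<Rightarrow> 'a set set \<Rightarrow> 'a set set \<Rightarrow> 'b set set \<Rightarrow> 'b set set" where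
  "folding_subcomplex \<phi> \<Delta> \<Gamma> \<Delta>' = \<Delta>' - (\<lambda>\<sigma>. \<phi> ` \<sigma>) ` faces \<Delta> \<Gamma>"

lemma folding_subcomplex_unique:
  assumes "relative_complex \<Delta>' \<Gamma>'"
    and "bij_betw (\<lambda>\<sigma>. \<phi> ` \<sigma>) (faces \<Delta> \<Gamma>) (faces \<Delta>' \<Gamma>')"
  shows "\<Gamma>' = folding_subcomplex \<phi> \<Delta> \<Gamma> \<Delta>'"
  using assms by (auto simp: folding_subcomplex_def relative_complex_def bij_betw_def faces_def)

end

theory Submission
  imports Defs
begin

text \<open>
  A folding map transports a partition of \<open>(\<Delta>, \<Gamma>)\<close> to its image interval by interval: taking
  direct images under \<open>\<phi>\<close> carries \<open>[R \<sigma>, \<sigma>]\<close> onto the whole of \<open>[\<phi> (R \<sigma>), \<phi> \<sigma>]\<close>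
  (\<open>image_interval\<close>), and since \<open>\<phi>\<close> is a bijection on faces, the transported intervals are again
  disjoint and exhaust the faces of the image.

  It remains to see that these intervals are indexed by the facets of the image.  Facets go to
  facets by hypothesis.  Conversely, every face of the image lies in one of the transported
  intervals, hence below the image of a facet; if it is maximal, it equals that image
  (\<open>facets_folding_image\<close>).
\<close>

text \<open>
  A set between the images of \<open>A\<close> and \<open>B\<close> is the image of the part of \<open>B\<close> lying over it, and
  that part contains \<open>A\<close>.
\<close>

lemma image_interval:
  assumes "A \<subseteq> B"
  shows "(`) f ` {A..B} = {f ` A..f ` B}"
proof
  show "{f ` A..f ` B} \<subseteq> (`) f ` {A..B}"
  proof
    fix \<rho> assume "\<rho> \<in> {f ` A..f ` B}"
    then have "f ` (B \<inter> f -` \<rho>) = \<rho>" and "B \<inter> f -` \<rho> \<in> {A..B}"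
      using assms by auto
    then show "\<rho> \<in> (`) f ` {A..B}"
      by (metis imageI)
  qed
qed (clarsimp simp: image_mono)

text \<open>
  A maximal face of the image comes from a face lying below some facet \<open>\<sigma>\<close>, hence lies below the
  face \<open>\<phi> ` \<sigma>\<close> of the image and equals it by maximality.  In a partitionable complex \<open>below\<close> can
  be read off the partition: a face lies below the top of the interval that contains it.
\<close>

lemma facets_folding_image:
  assumes image: "faces \<Delta>' \<Gamma>' = (`) \<phi> ` faces \<Delta> \<Gamma>"
    and facets: "(`) \<phi> ` facets \<Delta> \<Gamma> \<subseteq> facets \<Delta>' \<Gamma>'"
    and below: "\<And>\<rho>. \<rho> \<in> faces \<Delta> \<Gamma> \<Longrightarrow> \<exists>\<sigma>\<in>facets \<Delta> \<Gamma>. \<rho> \<subseteq> \<sigma>"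
  shows "facets \<Delta>' \<Gamma>' = (`) \<phi> ` facets \<Delta> \<Gamma>"
proof
  show "facets \<Delta>' \<Gamma>' \<subseteq> (`) \<phi> ` facets \<Delta> \<Gamma>"
  proof
    fix \<tau> assume \<tau>: "\<tau> \<in> facets \<Delta>' \<Gamma>'"
    then obtain \<rho> where \<rho>: "\<rho> \<in> faces \<Delta> \<Gamma>" "\<tau> = \<phi> ` \<rho>"
      using image by (auto simp: facets_def)
    obtain \<sigma> where \<sigma>: "\<sigma> \<in> facets \<Delta> \<Gamma>" "\<rho> \<subseteq> \<sigma>"
      using below[OF \<rho>(1)] by blast
    have "\<phi> ` \<sigma> \<in> faces \<Delta>' \<Gamma>'" and "\<tau> \<subseteq> \<phi> ` \<sigma>"
      using \<sigma> \<rho>(2) facets by (auto simp: facets_def)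
    then have "\<phi> ` \<sigma> = \<tau>"
      using \<tau> by (simp add: facets_def)
    then show "\<tau> \<in> (`) \<phi> ` facets \<Delta> \<Gamma>"
      using \<sigma>(1) by blast
  qed
qed (fact facets)

theorem lemma3p11:
  fixes \<Delta> \<Gamma> :: "'a set set" and \<Delta>' :: "'b set set" and \<phi> :: "'a \<Rightarrow> 'b"
  assumes "relative_complex \<Delta> \<Gamma>"
    and "folding_map \<phi> \<Delta> \<Gamma> \<Delta>'"
    and "partitionable \<Delta> \<Gamma>"
  shows "partitionable \<Delta>' (folding_subcomplex \<phi> \<Delta> \<Gamma> \<Delta>')"
proof -
  define \<Gamma>' where "\<Gamma>' = folding_subcomplex \<phi> \<Delta> \<Gamma> \<Delta>'"
  obtain \<Gamma>'' where "relative_complex \<Delta>' \<Gamma>''"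
    and bij'': "bij_betw ((`) \<phi>) (faces \<Delta> \<Gamma>) (faces \<Delta>' \<Gamma>'')"
    and facets'': "\<forall>\<sigma>\<in>facets \<Delta> \<Gamma>. \<phi> ` \<sigma> \<in> facets \<Delta>' \<Gamma>''"
    using assms(2) unfolding folding_map_def by blast
  then have "\<Gamma>'' = \<Gamma>'"
    unfolding \<Gamma>'_def by (intro folding_subcomplex_unique)
  then have inj: "inj_on ((`) \<phi>) (faces \<Delta> \<Gamma>)"
    and image: "faces \<Delta>' \<Gamma>' = (`) \<phi> ` faces \<Delta> \<Gamma>"
    and facets: "(`) \<phi> ` facets \<Delta> \<Gamma> \<subseteq> facets \<Delta>' \<Gamma>'"
    using bij'' facets'' by (auto simp: bij_betw_def)

  obtain R where R: "\<And>\<sigma>. \<sigma> \<in> facets \<Delta> \<Gamma> \<Longrightarrow> R \<sigma> \<in> faces \<Delta> \<Gamma> \<and> R \<sigma> \<subseteq> \<sigma>"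
    and disj: "disjoint_family_on (\<lambda>\<sigma>. {R \<sigma>..\<sigma>}) (facets \<Delta> \<Gamma>)"
    and cover: "faces \<Delta> \<Gamma> = (\<Union>\<sigma>\<in>facets \<Delta> \<Gamma>. {R \<sigma>..\<sigma>})"
    using assms(3) unfolding partitionable_def by blast

  have facets': "facets \<Delta>' \<Gamma>' = (`) \<phi> ` facets \<Delta> \<Gamma>"
  proof (rule facets_folding_image[OF image facets])
    show "\<exists>\<sigma>\<in>facets \<Delta> \<Gamma>. \<rho> \<subseteq> \<sigma>" if "\<rho> \<in> faces \<Delta> \<Gamma>" for \<rho>
      using that unfolding cover by auto
  qed

  define R' where "R' \<tau> = \<phi> ` R (inv_into (faces \<Delta> \<Gamma>) ((`) \<phi>) \<tau>)" for \<tau>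
  have R': "R' (\<phi> ` \<sigma>) = \<phi> ` R \<sigma>" if "\<sigma> \<in> facets \<Delta> \<Gamma>" for \<sigma>
    using that inv_into_f_f[OF inj] by (simp add: R'_def facets_def)
  have interval: "{R' (\<phi> ` \<sigma>)..\<phi> ` \<sigma>} = (`) \<phi> ` {R \<sigma>..\<sigma>}" if "\<sigma> \<in> facets \<Delta> \<Gamma>" for \<sigma>
    using that R by (simp add: R' image_interval)

  have "R' \<tau> \<in> faces \<Delta>' \<Gamma>' \<and> R' \<tau> \<subseteq> \<tau>" if "\<tau> \<in> facets \<Delta>' \<Gamma>'" for \<tau>
    using that R unfolding facets' image by (clarsimp simp: R' image_mono)
  moreover have "disjoint_family_on (\<lambda>\<tau>. {R' \<tau>..\<tau>}) (facets \<Delta>' \<Gamma>')"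
  unfolding disjoint_family_on_def
  proof (intro ballI impI)
    fix \<tau>\<^sub>1 \<tau>\<^sub>2
    assume "\<tau>\<^sub>1 \<in> facets \<Delta>' \<Gamma>'" "\<tau>\<^sub>2 \<in> facets \<Delta>' \<Gamma>'" and ne: "\<tau>\<^sub>1 \<noteq> \<tau>\<^sub>2"
    then obtain \<sigma>\<^sub>1 \<sigma>\<^sub>2 where \<sigma>: "\<sigma>\<^sub>1 \<in> facets \<Delta> \<Gamma>" "\<sigma>\<^sub>2 \<in> facets \<Delta> \<Gamma>"
      and \<tau>: "\<tau>\<^sub>1 = \<phi> ` \<sigma>\<^sub>1" "\<tau>\<^sub>2 = \<phi> ` \<sigma>\<^sub>2"
      unfolding facets' by blast
    have "{R \<sigma>\<^sub>1..\<sigma>\<^sub>1} \<inter> {R \<sigma>\<^sub>2..\<sigma>\<^sub>2} = {}"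
      using disjoint_family_onD[OF disj \<sigma>] ne \<tau> by blast
    moreover have "{R \<sigma>\<^sub>1..\<sigma>\<^sub>1} \<subseteq> faces \<Delta> \<Gamma>" "{R \<sigma>\<^sub>2..\<sigma>\<^sub>2} \<subseteq> faces \<Delta> \<Gamma>"
      using \<sigma> cover by blast+
    ultimately show "{R' \<tau>\<^sub>1..\<tau>\<^sub>1} \<inter> {R' \<tau>\<^sub>2..\<tau>\<^sub>2} = {}"
      unfolding \<tau> using inj_on_image_Int[OF inj] by (metis \<sigma> image_empty interval)
  qed
  moreover have "faces \<Delta>' \<Gamma>' = (\<Union>\<tau>\<in>facets \<Delta>' \<Gamma>'. {R' \<tau>..\<tau>})"
  proof -
    have "faces \<Delta>' \<Gamma>' = (\<Union>\<sigma>\<in>facets \<Delta> \<Gamma>. (`) \<phi> ` {R \<sigma>..\<sigma>})"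
      unfolding image cover by (rule image_UN)
    also have "\<dots> = (\<Union>\<sigma>\<in>facets \<Delta> \<Gamma>. {R' (\<phi> ` \<sigma>)..\<phi> ` \<sigma>})"
      by (simp add: interval)
    also have "\<dots> = (\<Union>\<tau>\<in>facets \<Delta>' \<Gamma>'. {R' \<tau>..\<tau>})"
      unfolding facets' by (simp add: image_image)
    finally show ?thesis .
  qed
  ultimately show ?thesis
    unfolding partitionable_def \<Gamma>'_def by blast
qed

end
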